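(* Let $n \geq 2$ be an integer. Let $x_1 \geq x_2 \geq \cdots \geq x_n$ and $y_1 \geq y_2 \geq \cdots \geq y_n$ be $2n$ real numbers such that $$0 = x_1 + x_2 + \cdots + x_n = y_1 + y_2 + \cdots + y_n$$ and $$1 = x_1^2 + x_2^2 + \cdots + x_n^2 = y_1^2 + y_2^2 + \cdots + y_n^2.$$ Then $$\sum_{i=1}^n (x_i y_i - x_i y_{n+1-i}) \geq \frac{2}{\sqrt{n-1}}.$$ *)

theory Defs
  imports Complex_Main
begin

end

(*
  For a uniformly random permutation p, the sum S = (SUM i. x i * y (p i)) has mean 0 and second
  moment 1/(n - 1).  By the rearrangement inequality S lies between the two extreme values
  m = (SUM i. x i * y (n + 1 - i)) and M = (SUM i. x i * y i), so averaging (M - S)(S - m) >= 0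
  gives 1/(n - 1) <= - M m <= (M - m)^2 / 4.
*)
theory Submission
  imports Defs "HOL-Combinatorics.Permutations"
begin

text \<open>Induction on the largest element \<open>b\<close>: redirecting \<open>p\<close> so that
  it fixes \<open>b\<close> does not decrease the sum, and what remains is a permutation of the
  smaller set.\<close>

lemma rearrangement_inequality:
  fixes x y :: "'a::linorder \<Rightarrow> 'b::linordered_idom"
  assumes "finite S" "p permutes S" "mono_on S x" "mono_on S y"
  shows "(\<Sum>i\<in>S. x i * y (p i)) \<le> (\<Sum>i\<in>S. x i * y i)"
  using assms
proof (induction S arbitrary: p rule: finite_linorder_max_induct)
  case empty
  then show ?case by simp
next
  case (insert b A)
  \<comment> \<open>\<open>?q\<close> fixes \<open>b\<close>, sends the preimage of \<open>b\<close>
    under \<open>p\<close> to \<open>p b\<close>, and agrees with \<open>p\<close>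
    elsewhere.\<close>
  let ?q = "transpose b (p b) \<circ> p"
  have b: "b \<notin> A" using insert.hyps by blast
  have mono: "mono_on A x" "mono_on A y"
    using insert.prems(2,3) by (auto intro: mono_on_subset)
  have q: "?q permutes A" by (rule permutes_insert_lemma[OF insert.prems(1)])
  have IH: "(\<Sum>i\<in>A. x i * y (?q i)) \<le> (\<Sum>i\<in>A. x i * y i)"
    by (rule insert.IH[OF q mono])
  have swap: "(\<Sum>i\<in>insert b A. x i * y (p i)) \<le> x b * y b + (\<Sum>i\<in>A. x i * y (?q i))"
  proof (cases "p b = b")
    case True
    then show ?thesis using b insert.hyps by simp
  next
    case False
    obtain k where k: "p k = b" using permutes_surj[OF insert.prems(1)] by (metis surjD)
    have pin: "inj p" by (rule permutes_inj[OF insert.prems(1)])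
    have kA: "k \<in> A"
      using k False permutes_not_in[OF insert.prems(1), of k] by (metis insert_iff)
    have lA: "p b \<in> A"
      using permutes_in_image[OF insert.prems(1), of b] False by simp
    have rest: "(\<Sum>i\<in>A-{k}. x i * y (?q i)) = (\<Sum>i\<in>A-{k}. x i * y (p i))"
    proof (rule sum.cong)
      fix i assume i: "i \<in> A - {k}"
      then have "p i \<noteq> b" "p i \<noteq> p b" using k b injD[OF pin] by (metis DiffD1 DiffD2 singletonI)+
      then show "x i * y (?q i) = x i * y (p i)" by simp
    qed simp
    have "x k \<le> x b" "y (p b) \<le> y b"
      using kA lA insert.hyps(2)
      by (auto intro: mono_onD[OF insert.prems(2)] mono_onD[OF insert.prems(3)] less_imp_le)
    \<comment> \<open>This product is exactly the gain when passing from \<open>p\<close> to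
      \<open>?q\<close>: only the terms at \<open>b\<close> and \<open>k\<close> change.\<close>
    then have "0 \<le> (x b - x k) * (y b - y (p b))" by simp
    then show ?thesis
      using b insert.hyps(1) kA k rest
      by (simp add: sum.remove[OF insert.hyps(1) kA] algebra_simps)
  qed
  show ?case using swap IH b insert.hyps(1) by simp
qed

lemma rearrangement_inequality_antimono:
  fixes x y :: "'a::linorder \<Rightarrow> 'b::linordered_idom"
  assumes "finite S" "p permutes S" "antimono_on S x" "antimono_on S y"
  shows "(\<Sum>i\<in>S. x i * y (p i)) \<le> (\<Sum>i\<in>S. x i * y i)"
  using rearrangement_inequality[of S p "\<lambda>i. - x i" "\<lambda>i. - y i"] assms
  by (simp add: monotone_on_def)

text \<open>By symmetry the sum over \<open>p\<close> is the same at every position, so it can be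
  summed over all positions; each permutation then contributes the full sum of
  \<open>f\<close>.\<close>

lemma sum_permutations_apply:
  fixes f :: "'a \<Rightarrow> real"
  assumes S: "finite S" "i \<in> S"
  shows "real (card S) * (\<Sum>p | p permutes S. f (p i)) = fact (card S) * (\<Sum>j\<in>S. f j)"
proof -
  have const: "(\<Sum>p | p permutes S. f (p j)) = (\<Sum>p | p permutes S. f (p i))" if "j \<in> S" for j
    by (subst sum_permutations_compose_right[OF permutes_swap_id[OF S(2) that]]) simp
  have "real (card S) * (\<Sum>p | p permutes S. f (p i)) = (\<Sum>j\<in>S. \<Sum>p | p permutes S. f (p j))"
    by (simp add: const)
  also have "\<dots> = (\<Sum>p | p permutes S. \<Sum>j\<in>S. f (p j))" by (rule sum.swap)
  also have "\<dots> = (\<Sum>p | p permutes S. \<Sum>j\<in>S. f j)"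
    by (rule sum.cong) (auto intro!: sum.reindex_bij_betw permutes_imp_bij)
  finally show ?thesis using S by (simp add: card_permutations)
qed

text \<open>For fixed \<open>i\<close>, the sum over \<open>p\<close> of
  \<open>y (p i) * y (p k)\<close> has one common value for all \<open>k\<close> other than
  \<open>i\<close>. Adding over all \<open>k\<close>, including \<open>i\<close>, gives zero because
  the \<open>y\<close> sum to zero.\<close>

lemma sum_permutations_apply2:
  fixes y :: "'a \<Rightarrow> real"
  assumes S: "finite S" "i \<in> S" "j \<in> S" "i \<noteq> j" and y: "(\<Sum>i\<in>S. y i) = 0"
  shows "(real (card S) - 1) * (\<Sum>p | p permutes S. y (p i) * y (p j)) =
    - (\<Sum>p | p permutes S. (y (p i))\<^sup>2)"
proof -
  let ?B = "\<lambda>j. \<Sum>p | p permutes S. y (p i) * y (p j)"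
  \<comment> \<open>Precomposing with the transposition of \<open>j\<close> and \<open>k\<close>
    leaves \<open>p i\<close> alone, as \<open>i\<close> differs from both.\<close>
  have const: "?B k = ?B j" if "k \<in> S - {i}" for k
    using that S
    by (subst sum_permutations_compose_right[OF permutes_swap_id[of j S k]])
      (auto simp: transpose_def)
  have "(\<Sum>k\<in>S. ?B k) = (\<Sum>p | p permutes S. y (p i) * (\<Sum>k\<in>S. y (p k)))"
    by (subst sum.swap) (simp add: sum_distrib_left)
  also have "\<dots> = (\<Sum>p | p permutes S. y (p i) * (\<Sum>k\<in>S. y k))"
    by (intro sum.cong arg_cong2[where f = times] sum.reindex_bij_betw permutes_imp_bij) auto
  also have "\<dots> = 0" using y by simp
  finally have split: "?B i + (\<Sum>k\<in>S-{i}. ?B k) = 0" using S by (simp add: sum.remove[OF S(1,2)])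
  have "(\<Sum>k\<in>S-{i}. ?B k) = (real (card S) - 1) * ?B j"
  proof -
    have "(\<Sum>k\<in>S-{i}. ?B k) = (\<Sum>k\<in>S-{i}. ?B j)" by (rule sum.cong[OF refl const])
    moreover have "card S \<ge> 1" using S by (metis One_nat_def Suc_leI card_gt_0_iff empty_iff)
    ultimately show ?thesis using S by (simp add: of_nat_diff)
  qed
  with split show ?thesis unfolding power2_eq_square by linarith
qed

lemma sum_permutations_inner:
  fixes x y :: "'a \<Rightarrow> real"
  assumes S: "finite S" and y: "(\<Sum>i\<in>S. y i) = 0"
  shows "(\<Sum>p | p permutes S. \<Sum>i\<in>S. x i * y (p i)) = 0"
proof -
  have "(\<Sum>p | p permutes S. y (p i)) = 0" if "i \<in> S" for i
    using sum_permutations_apply[OF S that, of y] y S that by auto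
  then show ?thesis
    by (subst sum.swap) (simp flip: sum_distrib_left)
qed

text \<open>Expanding the square leaves only the second moments of the pairs \<open>y (p i)\<close>,
  \<open>y (p j)\<close>, which depend only on whether \<open>i = j\<close>.\<close>

lemma sum_permutations_inner_squared:
  fixes x y :: "'a \<Rightarrow> real"
  assumes S: "finite S" "card S \<ge> 2" and x: "(\<Sum>i\<in>S. x i) = 0" and y: "(\<Sum>i\<in>S. y i) = 0"
  shows "(\<Sum>p | p permutes S. (\<Sum>i\<in>S. x i * y (p i))\<^sup>2) =
    fact (card S) * (\<Sum>i\<in>S. (x i)\<^sup>2) * (\<Sum>i\<in>S. (y i)\<^sup>2) / (real (card S) - 1)"
proof -
  define n where "n = real (card S)"
  \<comment> \<open>\<open>A\<close> and \<open>C\<close> will be the diagonal and off-diagonal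
    values of \<open>?B\<close>.\<close>
  define A where "A = fact (card S) * (\<Sum>i\<in>S. (y i)\<^sup>2) / n"
  define C where "C = - A / (n - 1)"
  have n: "n \<ge> 2" using S by (simp add: n_def)
  let ?B = "\<lambda>i j. \<Sum>p | p permutes S. y (p i) * y (p j)"
  have diag: "?B i i = A" if "i \<in> S" for i
    using sum_permutations_apply[OF S(1) that, of "\<lambda>j. (y j)\<^sup>2"] n
    by (simp add: A_def n_def[symmetric] field_simps power2_eq_square)
  have off: "?B i j = C" if "i \<in> S" "j \<in> S" "i \<noteq> j" for i j
    using sum_permutations_apply2[OF S(1) that y] diag[OF that(1)] n
    by (simp add: C_def n_def[symmetric] field_simps power2_eq_square)
  \<comment> \<open>A constant plus a diagonal correction: the constant part contributes
    \<open>C\<close> times the square of the sum of the \<open>x i\<close>, which is zero.\<close>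
  have B: "?B i j = C + (if i = j then A - C else 0)" if "i \<in> S" "j \<in> S" for i j
    using diag off that by auto
  have "(\<Sum>p | p permutes S. (\<Sum>i\<in>S. x i * y (p i))\<^sup>2) =
      (\<Sum>p | p permutes S. \<Sum>i\<in>S. \<Sum>j\<in>S. x i * x j * (y (p i) * y (p j)))"
    by (simp add: power2_eq_square sum_product mult_ac)
  also have "\<dots> = (\<Sum>i\<in>S. \<Sum>p | p permutes S. \<Sum>j\<in>S. x i * x j * (y (p i) * y (p j)))"
    by (rule sum.swap)
  also have "\<dots> = (\<Sum>i\<in>S. \<Sum>j\<in>S. x i * x j * ?B i j)"
    by (subst sum.swap[of _ _ "{p. p permutes S}"]) (simp add: sum_distrib_left)
  also have "\<dots> = (\<Sum>i\<in>S. \<Sum>j\<in>S. C * (x i * x j) + (if i = j then (A - C) * (x i * x j) else 0))"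
    by (intro sum.cong refl) (simp add: B algebra_simps)
  also have "\<dots> = (\<Sum>i\<in>S. C * x i * (\<Sum>j\<in>S. x j)) + (\<Sum>i\<in>S. (A - C) * (x i)\<^sup>2)"
    using S by (simp add: sum.distrib sum_distrib_left power2_eq_square mult_ac)
  also have "\<dots> = (A - C) * (\<Sum>i\<in>S. (x i)\<^sup>2)" using x by (simp add: sum_distrib_left)
  also have "\<dots> = A * n / (n - 1) * (\<Sum>i\<in>S. (x i)\<^sup>2)"
    using n by (simp add: C_def field_simps)
  also have "\<dots> = fact (card S) * (\<Sum>i\<in>S. (x i)\<^sup>2) * (\<Sum>i\<in>S. (y i)\<^sup>2) / (n - 1)"
    using n by (simp add: A_def)
  finally show ?thesis by (simp add: n_def)
qed

theorem mainTheorem6: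
  fixes n :: nat and x y :: "nat \<Rightarrow> real"
  assumes "n \<ge> 2"
    and "\<And>i j. 1 \<le> i \<Longrightarrow> i \<le> j \<Longrightarrow> j \<le> n \<Longrightarrow> x i \<ge> x j"
    and "\<And>i j. 1 \<le> i \<Longrightarrow> i \<le> j \<Longrightarrow> j \<le> n \<Longrightarrow> y i \<ge> y j"
    and "(\<Sum>i=1..n. x i) = 0"
    and "(\<Sum>i=1..n. y i) = 0"
    and "(\<Sum>i=1..n. (x i)\<^sup>2) = 1"
    and "(\<Sum>i=1..n. (y i)\<^sup>2) = 1"
  shows "(\<Sum>i=1..n. x i * y i - x i * y (n + 1 - i)) \<ge> 2 / sqrt (real n - 1)"
proof -
  let ?S = "{1..n}" and ?P = "{p. p permutes {1..n}}"
  define T where "T p = (\<Sum>i\<in>?S. x i * y (p i))" for p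
  \<comment> \<open>The reversal, extended by the identity outside \<open>?S\<close> as
    \<open>permutes\<close> demands.\<close>
  define r where "r i = (if i \<in> ?S then n + 1 - i else i)" for i
  define M where "M = T id"
  define m where "m = T r"
  have r: "r permutes ?S"
    by (rule bij_imp_permutes, rule bij_betw_byWitness[where f' = r]) (auto simp: r_def)
  have rr: "r (r i) = i" for i by (auto simp: r_def)
  have ax: "antimono_on ?S x" and ay: "antimono_on ?S y"
    using assms(2,3) by (auto simp: monotone_on_def)
  have ayr: "antimono_on ?S (\<lambda>i. - y (r i))"
    using assms(3) by (auto simp: monotone_on_def r_def)
  have upper: "T p \<le> M" if "p permutes ?S" for p
    using rearrangement_inequality_antimono[OF _ that ax ay] by (simp add: T_def M_def)
  \<comment> \<open>The upper bound is applied to the negated reversed sequence and the permutation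
    \<open>r \<circ> p\<close>; since \<open>r\<close> is an involution, the two reversals cancel
    and the sums become \<open>- T p\<close> and \<open>- m\<close>.\<close>
  have lower: "m \<le> T p" if "p permutes ?S" for p
    using rearrangement_inequality_antimono[OF _ permutes_compose[OF that r] ax ayr]
    by (simp add: T_def m_def rr sum_negf)
  have mean: "(\<Sum>p\<in>?P. T p) = 0"
    unfolding T_def by (rule sum_permutations_inner) (use assms in auto)
  have second: "(\<Sum>p\<in>?P. (T p)\<^sup>2) = fact n / (real n - 1)"
    using sum_permutations_inner_squared[of ?S x y] assms by (simp add: T_def)
  have "0 \<le> (\<Sum>p\<in>?P. (M - T p) * (T p - m))"
    using upper lower by (intro sum_nonneg) auto
  also have "\<dots> = (\<Sum>p\<in>?P. (M + m) * T p - (T p)\<^sup>2 - M * m)"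
    by (simp add: algebra_simps power2_eq_square)
  also have "\<dots> = (M + m) * (\<Sum>p\<in>?P. T p) - (\<Sum>p\<in>?P. (T p)\<^sup>2) - fact n * (M * m)"
    by (simp add: sum_subtractf sum_distrib_left card_permutations)
  finally have "fact n * (1 / (real n - 1)) \<le> fact n * (- (M * m))"
    using mean second by simp
  then have "1 / (real n - 1) \<le> - (M * m)"
    by (simp only: mult_le_cancel_left_pos[OF fact_gt_zero])
  \<comment> \<open>The difference of the two sides is \<open>(M + m)\<^sup>2\<close>.\<close>
  also have "4 * (- (M * m)) \<le> (M - m)\<^sup>2"
    using zero_le_power2[of "M + m"] by (simp add: power2_eq_square algebra_simps)
  finally have "4 / (real n - 1) \<le> (M - m)\<^sup>2" by simp
  then have "(2 / sqrt (real n - 1))\<^sup>2 \<le> (M - m)\<^sup>2"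
    using assms(1) by (simp add: power_divide)
  moreover have "0 \<le> M - m" using upper[OF r] by (simp add: m_def)
  ultimately have "2 / sqrt (real n - 1) \<le> M - m" by (rule power2_le_imp_le)
  also have "M - m = (\<Sum>i=1..n. x i * y i - x i * y (n + 1 - i))"
    by (simp add: M_def m_def T_def r_def sum_subtractf)
  finally show ?thesis .
qed

end
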